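(* Let $a>0$ and $b\in\mathbb{R}$. If $F_{a,b}$ is a Bernstein function, or equivalently if $P_{a,b}$ is completely monotone, then $-1<b\le 0$ and $$0<a<\min\left\{K_0+b,\ 2(1+b)+2\sqrt{1+b}\right\},$$ where $$K_0=\frac{30\log 3-28}{(3\log 3-2)^2}\approx 2.952828006549551 .$$ In particular, $$a-b<K_0<3 .$$
   Context: A function $g\in C^\infty(0,\infty)$ is completely monotone if $(-1)^n g^{(n)}\ge 0$ on $(0,\infty)$ for every integer $n\ge 0$. A nonnegative smooth function $f$ on $(0,\infty)$ is a Bernstein function if $f'$ is completely monotone. For $a>0$, $b\in\mathbb{R}$, $x>0$: $F_{a,b}(x)=\left(1+\frac{a}{x}\right)^{x+b}$ and $P_{a,b}(x)=e^a-F_{a,b}(x)$. *)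

theory Defs
  imports "HOL-Analysis.Analysis"
begin

(* Functions on (0, \<infinity>) are represented by total functions of type real => real. At a
   point of the open half-line, an iterated derivative depends only on the values of the
   function near that point, so the values at x \<le> 0 play no role below. *)

definition smooth_on_pos :: "(real \<Rightarrow> real) \<Rightarrow> bool" where
  "smooth_on_pos g \<longleftrightarrow> (\<forall>n. \<forall>x>0. (deriv ^^ n) g field_differentiable (at x))"

definition completely_monotone :: "(real \<Rightarrow> real) \<Rightarrow> bool" where
  "completely_monotone g \<longleftrightarrow>
     smooth_on_pos g \<and> (\<forall>n. \<forall>x>0. (-1) ^ n * (deriv ^^ n) g x \<ge> 0)"

definition bernstein_function :: "(real \<Rightarrow> real) \<Rightarrow> bool" where
  "bernstein_function f \<longleftrightarrow>
     smooth_on_pos f \<and> (\<forall>x>0. f x \<ge> 0) \<and> completely_monotone (deriv f)"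

definition F :: "real \<Rightarrow> real \<Rightarrow> real \<Rightarrow> real" where
  "F a b x = (1 + a / x) powr (x + b)"

definition P :: "real \<Rightarrow> real \<Rightarrow> real \<Rightarrow> real" where
  "P a b x = exp a - F a b x"

definition K0 :: real where
  "K0 = (30 * ln 3 - 28) / (3 * ln 3 - 2)\<^sup>2"

end

theory Submission
  imports Defs
begin

text \<open>
  A Bernstein function \<open>F\<close> has a completely monotone derivative, and completely monotone functions are
  log-convex. For \<open>F a b\<close> the log-convexity of \<open>F'\<close> at one well-chosen point \<open>x = a * t\<close> already
  contains each of the two upper bounds on \<open>a\<close>.

  Log-convexity is usually read off from Bernstein's integral representation and the Cauchy-Schwarz
  inequality. Here it is derived from the signs of the derivatives alone
  (\<open>completely_monotone_nonneg_polynomial\<close>, \<open>completely_monotone_log_convex\<close>): repeated integration by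
  parts against a nonnegative polynomial produces linear inequalities between the derivatives at a
  point, and polynomials of growing degree give the sharp constant in the limit.

  Applied to \<open>F'\<close> at \<open>x = a * t\<close>, it says that the quadratic \<open>n * y\<^sup>2 - M * y + n\<^sup>2\<close> is not positive
  (\<open>bernstein_F_quadratic\<close>), where \<open>n\<close> and \<open>M\<close> are polynomials and only the value \<open>y \<ge> 0\<close>, a
  multiple of the logarithmic derivative of \<open>F\<close>, contains a logarithm. Letting \<open>t\<close> tend to 0 in
  \<open>y \<ge> 0\<close> gives \<open>b \<le> 0\<close>. The bounds then come from two ways of using the quadratic.

  First, its discriminant cannot be negative (\<open>bernstein_F_discriminant\<close>). This is a polynomial condition
  for every \<open>t > 0\<close>; values of \<open>n\<close> near \<open>- b\<close> exclude \<open>b \<le> -1\<close>, and \<open>sqrt n = 1 + sqrt (1 + b) / 2\<close>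
  gives \<open>a < 2 * (1 + b) + 2 * sqrt (1 + b)\<close>.

  Second, evaluating \<open>y\<close> itself at \<open>t = 1/3\<close> gives \<open>a - b < 2.95 < K0\<close> (\<open>bernstein_F_imp_K0_bound\<close>).
  The constant \<open>K0\<close> is what the same inequality yields for \<open>b = 0\<close> at \<open>t = 1/2\<close>.
\<close>

section \<open>Completely monotone functions are log-convex\<close>

lemma higher_derivative_signed:
  assumes "completely_monotone g" "x > 0"
  shows "((\<lambda>x. (-1) ^ n * (deriv ^^ n) g x) has_real_derivative
            - ((-1) ^ Suc n * (deriv ^^ Suc n) g x)) (at x)"
proof -
  have "((deriv ^^ n) g has_real_derivative (deriv ^^ Suc n) g x) (at x)"
    using assms unfolding completely_monotone_def smooth_on_pos_def
    by (simp add: field_differentiable_derivI)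
  from DERIV_cmult[OF this, of "(-1) ^ n"] show ?thesis by simp
qed

text \<open>
  Write \<open>G n\<close> for \<open>(-1)\<^sup>n\<close> times the \<open>n\<close>-th derivative of \<open>g\<close>, and \<open>d\<close> for the degree of \<open>q\<close>.
  Integrating \<open>q (y - x) * G (d + 1) y \<ge> 0\<close> by parts over \<open>y \<ge> x\<close> gives the sum below as the
  boundary terms at \<open>x\<close>. The proof replaces the integral by the function \<open>T\<close> of
  boundary terms at \<open>y\<close>, whose derivative telescopes to \<open>- q (y - x) * G (d + 1) y \<le> 0\<close>. The
  boundary terms at infinity are controlled by their sign: for large \<open>y\<close> all derivatives of \<open>q\<close> are
  nonnegative at \<open>y - x\<close>, so that \<open>T y \<ge> 0\<close>, and therefore \<open>T x \<ge> T y \<ge> 0\<close>.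
\<close>

lemma completely_monotone_nonneg_polynomial:
  fixes q :: "real poly"
  assumes g: "completely_monotone g" and x: "x > 0"
    and q_nonneg: "\<And>z. z \<ge> 0 \<Longrightarrow> poly q z \<ge> 0" and lead: "lead_coeff q > 0"
  shows "(\<Sum>k\<le>degree q. fact k * coeff q k *
            ((-1) ^ (degree q - k) * (deriv ^^ (degree q - k)) g x)) \<ge> 0"
proof -
  define d where "d = degree q"
  define G where "G n y = (-1) ^ n * (deriv ^^ n) g y" for n y
  define Q where "Q k = (pderiv ^^ k) q" for k
  define T where "T y = (\<Sum>k\<le>d. poly (Q k) (y - x) * G (d - k) y)" for y
  have G_nonneg: "G n y \<ge> 0" if "y > 0" for n y
    using g that by (simp add: G_def completely_monotone_def)
  have G_deriv: "(G n has_real_derivative - G (Suc n) y) (at y)" if "y > 0" for n y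
    using higher_derivative_signed[OF g that, of n] by (simp add: G_def[abs_def])
  have Q_deriv: "((\<lambda>y. poly (Q k) (y - x)) has_real_derivative poly (Q (Suc k)) (y - x)) (at y)"
    for k y
    unfolding Q_def by (auto intro!: derivative_eq_intros)
  have T_deriv: "(T has_real_derivative - (poly q (y - x) * G (Suc d) y)) (at y)"
    if y: "y > 0" for y
  proof -
    define h where "h k = poly (Q k) (y - x) * G (Suc d - k) y" for k
    have "(T has_real_derivative
        (\<Sum>k\<le>d. poly (Q k) (y - x) * - G (Suc (d - k)) y + poly (Q (Suc k)) (y - x) * G (d - k) y)) (at y)"
      unfolding T_def[abs_def] by (intro DERIV_sum DERIV_mult' Q_deriv G_deriv y)
    also have "(\<Sum>k\<le>d. poly (Q k) (y - x) * - G (Suc (d - k)) y + poly (Q (Suc k)) (y - x) * G (d - k) y)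
        = (\<Sum>k\<le>d. h (Suc k) - h k)"
      by (intro sum.cong refl) (auto simp: h_def Suc_diff_le)
    also have "\<dots> = h (Suc d) - h 0"
      by (induction d) auto
    also have "\<dots> = - (poly q (y - x) * G (Suc d) y)"
    proof -
      have "degree (Q d) = 0"
        by (simp add: Q_def d_def degree_higher_pderiv)
      hence "Q (Suc d) = 0"
        by (simp add: Q_def pderiv_eq_0_iff)
      moreover have "Q 0 = q"
        by (simp add: Q_def)
      ultimately show ?thesis by (simp add: h_def)
    qed
    finally show ?thesis .
  qed
  have "\<forall>\<^sub>F z in at_top. \<forall>k\<in>{..d}. poly (Q k) z \<ge> 0"
  proof (intro eventually_ball_finite ballI)
    fix k assume "k \<in> {..d}"
    have "lead_coeff (Q k) > 0"
      using \<open>k \<in> {..d}\<close> lead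
      by (simp add: Q_def degree_higher_pderiv coeff_higher_pderiv d_def pochhammer_pos)
    from poly_pinfty_gt_lc[OF this] this
    show "\<forall>\<^sub>F z in at_top. poly (Q k) z \<ge> 0"
      unfolding eventually_at_top_linorder by (metis less_le_trans less_imp_le)
  qed simp
  then obtain B where B: "\<And>z k. z \<ge> B \<Longrightarrow> k \<le> d \<Longrightarrow> poly (Q k) z \<ge> 0"
    unfolding eventually_at_top_linorder by auto
  define z where "z = max B 0 + x"
  have "0 \<le> T z"
    unfolding T_def using x by (intro sum_nonneg mult_nonneg_nonneg B G_nonneg) (auto simp: z_def)
  also have "T z \<le> T x"
  proof (rule DERIV_nonpos_imp_nonincreasing[of x z T])
    fix y assume "x \<le> y" "y \<le> z"
    thus "\<exists>D. (T has_real_derivative D) (at y) \<and> D \<le> 0"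
      using x T_deriv[of y] q_nonneg[of "y - x"] G_nonneg[of y "Suc d"] by fastforce
  qed (simp add: z_def)
  also have "T x = (\<Sum>k\<le>d. fact k * coeff q k * G (d - k) x)"
    unfolding T_def
    by (intro sum.cong refl)
       (simp add: Q_def poly_0_coeff_0 coeff_higher_pderiv pochhammer_fact)
  finally show ?thesis by (simp add: G_def d_def)
qed

text \<open>
  The previous lemma for \<open>q z = z ^ N * (1 - s * z)\<^sup>2\<close> involves only \<open>g\<close>, \<open>g'\<close> and \<open>g''\<close>.
  With \<open>s = t / (N + 1)\<close> it says that a quadratic polynomial in \<open>t\<close> is nonnegative, and the limit
  \<open>N \<longlonglongrightarrow> \<infinity>\<close> removes the error factor \<open>1 + 1 / (N + 1)\<close>. The claim is that the discriminant of the
  limiting quadratic is not positive.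
\<close>

lemma completely_monotone_log_convex:
  assumes g: "completely_monotone g" and x: "x > 0"
  shows "(deriv g x)\<^sup>2 \<le> g x * deriv (deriv g) x"
proof -
  define G where "G n = (-1) ^ n * (deriv ^^ n) g x" for n :: nat
  have G_nonneg: "G n \<ge> 0" for n
    using g x by (simp add: G_def completely_monotone_def)
  have moment: "0 \<le> G 2 - 2 * t * G 1 + t\<^sup>2 * (1 + 1 / real (Suc N)) * G 0" if t: "t \<noteq> 0" for t N
  proof -
    define s where "s = t / real (Suc N)"
    define q where "q = monom 1 N * [:1, - s:]\<^sup>2"
    have s: "s \<noteq> 0" using t by (simp add: s_def)
    have q: "q = monom (s\<^sup>2) (N + 2) + monom (- 2 * s) (N + 1) + monom 1 N"
      by (rule poly_eqI) (auto simp: q_def power2_eq_square coeff_monom_mult coeff_pCons numeral_2_eq_2 split: nat.splits)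
    have c: "coeff q k = (if k = N + 2 then s\<^sup>2 else if k = N + 1 then - 2 * s else if k = N then 1 else 0)" for k
      by (simp add: q)
    have deg: "degree q = N + 2"
      using s by (intro antisym degree_le le_degree) (auto simp: c)
    have "0 \<le> (\<Sum>k\<le>degree q. fact k * coeff q k * G (degree q - k))"
      unfolding G_def
    proof (rule completely_monotone_nonneg_polynomial[OF g x])
      show "poly q z \<ge> 0" if "z \<ge> 0" for z
        using that by (simp add: q_def poly_monom)
      show "lead_coeff q > 0" unfolding deg using s by (simp add: c)
    qed
    also have "\<dots> = (\<Sum>k\<in>{N, N + 1, N + 2}. fact k * coeff q k * G (degree q - k))"
      by (rule sum.mono_neutral_right) (auto simp: deg c)
    also have "\<dots> = fact N * (G 2 - 2 * (real (Suc N) * s) * G 1 + (real (Suc N) * s) * (real (Suc (Suc N)) * s) * G 0)"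
      by (simp add: deg c power2_eq_square algebra_simps)
    also have "real (Suc N) * s = t" by (simp add: s_def)
    also have "real (Suc (Suc N)) * s = t * (1 + 1 / real (Suc N))"
      by (simp add: s_def field_simps)
    finally have "0 \<le> fact N * (G 2 - 2 * t * G 1 + t\<^sup>2 * (1 + 1 / real (Suc N)) * G 0)"
      by (simp only: power2_eq_square mult_ac)
    thus ?thesis
      using fact_gt_zero[of N, where ?'a = real] by (meson zero_le_mult_iff not_le)
  qed
  have quadratic: "0 \<le> G 2 - 2 * t * G 1 + t\<^sup>2 * G 0" for t
  proof (cases "t = 0")
    case False
    have "(\<lambda>N. G 2 - 2 * t * G 1 + t\<^sup>2 * (1 + 1 / real (Suc N)) * G 0)
        \<longlonglongrightarrow> G 2 - 2 * t * G 1 + t\<^sup>2 * (1 + 0) * G 0"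
      by (intro tendsto_intros LIMSEQ_Suc lim_1_over_n)
    from LIMSEQ_le_const[OF this, of 0] moment[OF False] show ?thesis by auto
  qed (use G_nonneg in simp)
  have "(G 1)\<^sup>2 \<le> G 0 * G 2"
  proof (cases "G 0 = 0")
    case True
    have "G 1 = 0"
    proof (rule ccontr)
      assume "G 1 \<noteq> 0"
      with quadratic[of "(G 2 + 1) / (2 * G 1)"] True show False by simp
    qed
    thus ?thesis using True by simp
  next
    case False
    hence "G 0 > 0" using G_nonneg[of 0] by simp
    have "0 \<le> G 0 * (G 2 - 2 * (G 1 / G 0) * G 1 + (G 1 / G 0)\<^sup>2 * G 0)"
      by (intro mult_nonneg_nonneg quadratic G_nonneg)
    also have "\<dots> = G 0 * G 2 - (G 1)\<^sup>2"
      using False by (simp add: field_simps power2_eq_square)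
    finally show ?thesis by simp
  qed
  thus ?thesis by (simp add: G_def numeral_2_eq_2)
qed

section \<open>The logarithmic derivative of F\<close>

lemma deriv_eq_on_pos:
  fixes f h :: "real \<Rightarrow> real"
  assumes "x > 0" "(h has_real_derivative D) (at x)" "\<And>y. y > 0 \<Longrightarrow> f y = h y"
  shows "deriv f x = D"
proof (rule DERIV_imp_deriv)
  show "(f has_real_derivative D) (at x)"
    using assms by (intro has_field_derivative_transform_within_open[OF assms(2), of "{0<..}"]) auto
qed

definition log_deriv_F :: "real \<Rightarrow> real \<Rightarrow> real \<Rightarrow> real" where
  "log_deriv_F a b x = ln (1 + a / x) - a * (x + b) / (x * (x + a))"

lemma F_pos: "a > 0 \<Longrightarrow> x > 0 \<Longrightarrow> F a b x > 0"
  by (simp add: F_def add_nonneg_eq_0_iff)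

lemma F_has_derivative:
  assumes "a > 0" "x > 0"
  shows "(F a b has_real_derivative F a b x * log_deriv_F a b x) (at x)"
proof -
  have F_exp: "F a b y = exp ((y + b) * ln (1 + a / y))" if "y > 0" for y
  proof -
    have "1 + a / y > 0" using that assms by (simp add: add_pos_pos)
    thus ?thesis by (simp add: F_def powr_def)
  qed
  have "1 + a / x > 0" using assms by (simp add: add_pos_pos)
  hence "((\<lambda>y. exp ((y + b) * ln (1 + a / y))) has_real_derivative
      exp ((x + b) * ln (1 + a / x)) * log_deriv_F a b x) (at x)"
    using assms
    by (auto intro!: derivative_eq_intros simp: log_deriv_F_def) (simp add: field_simps)
  hence "((\<lambda>y. exp ((y + b) * ln (1 + a / y))) has_real_derivative F a b x * log_deriv_F a b x) (at x)"
    using F_exp assms by simp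
  thus ?thesis
    by (rule has_field_derivative_transform_within_open[of _ _ _ "{0<..}"]) (use F_exp assms in auto)
qed

lemma log_deriv_F_has_derivative:
  assumes "a > 0" "x > 0"
  shows "(log_deriv_F a b has_real_derivative a * ((2 * b - a) * x + a * b) / (x * (x + a))\<^sup>2) (at x)"
proof -
  have "1 + a / x > 0" using assms by (simp add: add_pos_pos)
  thus ?thesis
    unfolding log_deriv_F_def[abs_def] using assms
    by (auto intro!: derivative_eq_intros) (simp add: divide_simps, simp add: algebra_simps power2_eq_square)
qed

lemma log_deriv_F_has_second_derivative:
  assumes "a > 0" "x > 0"
  shows "((\<lambda>x. a * ((2 * b - a) * x + a * b) / (x * (x + a))\<^sup>2) has_real_derivative
    a * ((2 * b - a) * (x * (x + a)) - 2 * ((2 * b - a) * x + a * b) * (2 * x + a)) / (x * (x + a)) ^ 3) (at x)"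
  using assms
  by (auto intro!: derivative_eq_intros) (simp add: divide_simps, simp add: algebra_simps power2_eq_square eval_nat_numeral)

section \<open>A quadratic inequality at every scale\<close>

text \<open>
  The two consequences of the Bernstein property on which all the bounds rest, namely \<open>F' \<ge> 0\<close> and the
  log-convexity of \<open>F'\<close>, at the point \<open>x = a * t\<close>. If \<open>l\<close> is the logarithmic derivative of \<open>F\<close>, the
  latter reads \<open>l\<^sup>2 * l' + l * l'' - l'\<^sup>2 \<ge> 0\<close>. Up to powers of
  \<open>a * t * (t + 1)\<close>, \<open>l\<close> is \<open>y\<close> and \<open>l'\<close> is \<open>- n\<close>. The result is a quadratic inequality for \<open>y\<close>, the only
  quantity that contains a logarithm, with coefficients polynomial in \<open>a\<close>, \<open>b\<close> and \<open>t\<close>.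
\<close>

lemma bernstein_F_quadratic:
  fixes a b t :: real
  assumes a: "a > 0" and bern: "bernstein_function (F a b)" and t: "t > 0"
  defines "y \<equiv> a * (t * (t + 1) * ln (1 + 1 / t) - t) - b"
    and "n \<equiv> (a - 2 * b) * t - b"
  shows "y \<ge> 0"
    and "n * y\<^sup>2 + n\<^sup>2 \<le> (2 * (2 * t + 1) * n - (a - 2 * b) * (t * (t + 1))) * y"
proof -
  define f where "f = F a b"
  define l where "l = log_deriv_F a b"
  define l1 where "l1 x = a * ((2 * b - a) * x + a * b) / (x * (x + a))\<^sup>2" for x
  define l2 where "l2 x = a * ((2 * b - a) * (x * (x + a)) - 2 * ((2 * b - a) * x + a * b) * (2 * x + a)) / (x * (x + a)) ^ 3" for x
  have f': "(f has_real_derivative f x * l x) (at x)" if "x > 0" for x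
    using F_has_derivative[OF a that] by (simp add: f_def l_def)
  have l': "(l has_real_derivative l1 x) (at x)" if "x > 0" for x
    using log_deriv_F_has_derivative[OF a that] by (simp add: l_def l1_def)
  have l1': "(l1 has_real_derivative l2 x) (at x)" if "x > 0" for x
    using log_deriv_F_has_second_derivative[OF a that] by (simp add: l1_def[abs_def] l2_def)
  have d1: "deriv f x = f x * l x" if "x > 0" for x
    using f'[OF that] by (rule DERIV_imp_deriv)
  have d2: "deriv (deriv f) x = f x * ((l x)\<^sup>2 + l1 x)" if "x > 0" for x
    by (rule deriv_eq_on_pos[OF that _ d1])
       (use that in \<open>auto intro!: derivative_eq_intros f' l' simp: algebra_simps power2_eq_square\<close>)
  have d3: "deriv (deriv (deriv f)) x = f x * (l x ^ 3 + 3 * l x * l1 x + l2 x)" if "x > 0" for x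
    by (rule deriv_eq_on_pos[OF that _ d2])
       (use that in \<open>auto intro!: derivative_eq_intros f' l' l1' simp: algebra_simps eval_nat_numeral\<close>)
  define x where "x = a * t"
  have x: "x > 0" using a t by (simp add: x_def)
  have f_pos: "f x > 0" using F_pos[OF a x] by (simp add: f_def)
  have cm: "completely_monotone (deriv f)"
    using bern by (simp add: bernstein_function_def f_def)
  define D where "D = t * (t + 1)"
  define M where "M = 2 * (2 * t + 1) * n - (a - 2 * b) * D"
  have D: "D > 0" using t by (simp add: D_def)
  have xD: "x * (x + a) = a\<^sup>2 * D" by (simp add: x_def D_def algebra_simps power2_eq_square)
  have lx: "l x = y / (a * D)"
  proof -
    have "l x = ln (1 + 1 / t) - a * (a * t + b) / (a\<^sup>2 * D)"
      unfolding l_def log_deriv_F_def xD using a t by (simp add: x_def)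
    also have "\<dots> = y / (a * D)"
      using a D unfolding y_def D_def[symmetric] by (simp add: field_simps power2_eq_square)
    finally show ?thesis .
  qed
  have l1x: "l1 x = - n / (a * D)\<^sup>2"
    using a D unfolding l1_def xD by (simp add: n_def x_def field_simps eval_nat_numeral)
  have l2x: "l2 x = M / (a * D) ^ 3"
  proof -
    have "(2 * b - a) * (a\<^sup>2 * D) - 2 * ((2 * b - a) * x + a * b) * (2 * x + a) = a\<^sup>2 * M"
      by (simp add: x_def M_def n_def algebra_simps power2_eq_square)
    thus ?thesis
      using a D unfolding l2_def xD by (simp add: field_simps eval_nat_numeral)
  qed
  have "0 \<le> deriv f x"
    using cm x unfolding completely_monotone_def by (metis funpow_0 power_0 mult_1)
  hence "0 \<le> l x" using d1[OF x] f_pos by (simp add: zero_le_mult_iff)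
  moreover have "y = l x * (a * D)" using a D by (simp add: lx)
  ultimately show "y \<ge> 0" using a D by simp
  have "(f x * ((l x)\<^sup>2 + l1 x))\<^sup>2 \<le> f x * l x * (f x * (l x ^ 3 + 3 * l x * l1 x + l2 x))"
    using completely_monotone_log_convex[OF cm x] by (simp only: d1[OF x] d2[OF x] d3[OF x])
  hence "0 \<le> (f x)\<^sup>2 * ((l x)\<^sup>2 * l1 x + l x * l2 x - (l1 x)\<^sup>2)"
    by (simp add: algebra_simps eval_nat_numeral)
  hence "0 \<le> (l x)\<^sup>2 * l1 x + l x * l2 x - (l1 x)\<^sup>2"
    using f_pos by (simp add: zero_le_mult_iff)
  also have "\<dots> = (M * y - n * y\<^sup>2 - n\<^sup>2) / (a * D) ^ 4"
    unfolding lx l1x l2x using a D by (simp add: field_simps eval_nat_numeral)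
  finally show "n * y\<^sup>2 + n\<^sup>2 \<le> (2 * (2 * t + 1) * n - (a - 2 * b) * (t * (t + 1))) * y"
    using divide_less_0_iff[of "M * y - n * y\<^sup>2 - n\<^sup>2" "(a * D) ^ 4"] a D
    by (fold D_def, fold M_def) (auto simp: not_less)
qed

section \<open>The bounds on b and the square root bound\<close>

text \<open>
  As \<open>t\<close> tends to 0, the quantity \<open>y\<close> tends to \<open>- b\<close>, which is therefore nonnegative.
\<close>

lemma bernstein_F_imp_nonpos:
  assumes a: "a > 0" and bern: "bernstein_function (F a b)"
  shows "b \<le> 0"
proof (rule ccontr)
  assume "\<not> b \<le> 0"
  \<comment> \<open>At \<open>t = s\<^sup>2\<close> the estimate \<open>ln (1 + 1 / s\<^sup>2) \<le> 2 * ln (1 + 1 / s) \<le> 2 / s\<close> gives \<open>b \<le> 4 * a * s\<close>.\<close>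
  define s where "s = min 1 (b / (8 * a))"
  have s: "0 < s" "s \<le> 1" "8 * a * s \<le> b"
    using a \<open>\<not> b \<le> 0\<close> by (auto simp: s_def min_def field_simps)
  have "1 + 1 / s\<^sup>2 > 0" "1 + 1 / s > 0" using s by (simp_all add: add_pos_pos)
  moreover have "1 + 1 / s\<^sup>2 \<le> (1 + 1 / s)\<^sup>2"
    using s by (simp add: power2_eq_square field_simps)
  ultimately have "ln (1 + 1 / s\<^sup>2) \<le> 2 * ln (1 + 1 / s)"
    using ln_mono[of "1 + 1 / s\<^sup>2" "(1 + 1 / s)\<^sup>2"] ln_realpow[of "1 + 1 / s" 2] by simp
  also have "\<dots> \<le> 2 / s"
    using ln_add_one_self_le_self[of "1 / s"] s by simp
  finally have "s\<^sup>2 * (s\<^sup>2 + 1) * ln (1 + 1 / s\<^sup>2) \<le> s\<^sup>2 * (s\<^sup>2 + 1) * (2 / s)"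
    by (intro mult_left_mono) auto
  also have "\<dots> = 2 * s * (s\<^sup>2 + 1)"
    using s by (simp add: power2_eq_square)
  also have "\<dots> \<le> 2 * s * (1 + 1)"
    using s by (intro mult_left_mono add_right_mono) (auto simp: power_le_one)
  also have "\<dots> = 4 * s" by simp
  finally have "a * (s\<^sup>2 * (s\<^sup>2 + 1) * ln (1 + 1 / s\<^sup>2) - s\<^sup>2) \<le> a * (4 * s)"
    using a zero_le_power2[of s] by (intro mult_left_mono; linarith)
  moreover have "0 \<le> a * (s\<^sup>2 * (s\<^sup>2 + 1) * ln (1 + 1 / s\<^sup>2) - s\<^sup>2) - b"
    using bernstein_F_quadratic(1)[OF a bern, of "s\<^sup>2"] s by simp
  ultimately show False using s a \<open>\<not> b \<le> 0\<close> by (simp add: algebra_simps)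
qed

text \<open>
  A quadratic \<open>n * y\<^sup>2 - M * y + n\<^sup>2\<close> with \<open>n > 0\<close> that is not positive at some \<open>y \<ge> 0\<close> forces
  \<open>2 * sqrt n ^ 3 \<le> M\<close>. This eliminates \<open>y\<close>, and with it the logarithm. The free parameter \<open>t > 0\<close> is
  replaced by \<open>m = sqrt n\<close>, in terms of which the condition is the polynomial inequality below.
\<close>

lemma bernstein_F_discriminant:
  fixes a b m :: real
  assumes a: "a > 0" and bern: "bernstein_function (F a b)" and m: "m > 0" "m\<^sup>2 > - b"
  shows "(a - 2 * b) * (2 * m ^ 3 - m\<^sup>2 + b) \<le> (3 * m\<^sup>2 - b) * (m\<^sup>2 + b)"
proof -
  have b: "b \<le> 0" using bernstein_F_imp_nonpos[OF a bern] .
  define s where "s = a - 2 * b"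
  define t where "t = (m\<^sup>2 + b) / s"
  have s: "s > 0" using a b by (simp add: s_def)
  have t: "t > 0" using s m by (simp add: t_def)
  have n: "s * t - b = m\<^sup>2" using s by (simp add: t_def)
  define y where "y = a * (t * (t + 1) * ln (1 + 1 / t) - t) - b"
  define M where "M = 2 * (2 * t + 1) * m\<^sup>2 - s * (t * (t + 1))"
  have y: "y \<ge> 0"
    using bernstein_F_quadratic(1)[OF a bern t] by (simp add: y_def)
  have quad: "m\<^sup>2 * y\<^sup>2 + (m\<^sup>2)\<^sup>2 \<le> M * y"
    using bernstein_F_quadratic(2)[OF a bern t, folded y_def s_def] by (simp only: n M_def)
  have "y \<noteq> 0"
    using quad m by auto
  have "0 \<le> (m * y - m\<^sup>2)\<^sup>2" by simp
  hence "2 * m ^ 3 * y \<le> m\<^sup>2 * y\<^sup>2 + (m\<^sup>2)\<^sup>2"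
    by (simp add: algebra_simps eval_nat_numeral)
  with quad have "2 * m ^ 3 * y \<le> M * y" by linarith
  hence "2 * m ^ 3 \<le> M"
    using y \<open>y \<noteq> 0\<close> by simp
  hence "s * (2 * m ^ 3) \<le> s * M" using s by simp
  also have "s * M = 2 * (2 * (s * t) + s) * m\<^sup>2 - s * t * (s * t + s)"
    by (simp add: M_def algebra_simps)
  also have "s * t = m\<^sup>2 + b" using n by simp
  finally show ?thesis
    by (simp add: s_def algebra_simps eval_nat_numeral)
qed

text \<open>
  Near the left end of the range of \<open>m\<close>, that is for \<open>m\<^sup>2\<close> slightly above \<open>- b\<close>, the discriminant
  condition fails when \<open>b \<le> -1\<close>.
\<close>

lemma bernstein_F_imp_gt_minus_one:
  assumes a: "a > 0" and bern: "bernstein_function (F a b)"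
  shows "b > -1"
proof (rule ccontr)
  assume "\<not> b > -1"
  \<comment> \<open>If \<open>b \<le> -1\<close> and \<open>m\<^sup>2 = - b + d\<close>, the left side is at least \<open>2 * (a - 2 * b) * d\<close>
      and the right side is \<open>(3 * d - 4 * b) * d\<close>; any \<open>d < 2 * a / 3\<close> separates them.\<close>
  define d where "d = a / 3"
  define m where "m = sqrt (- b + d)"
  have d: "d > 0" using a by (simp add: d_def)
  have m2: "m\<^sup>2 = - b + d"
    using \<open>\<not> b > -1\<close> d by (simp add: m_def)
  have m1: "m > 1"
    using \<open>\<not> b > -1\<close> d by (simp add: m_def)
  have "(a - 2 * b) * (2 * m ^ 3 - m\<^sup>2 + b) \<le> (3 * m\<^sup>2 - b) * (m\<^sup>2 + b)"
    using bernstein_F_discriminant[OF a bern, of m] m1 m2 d by simp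
  hence upper: "(a - 2 * b) * (2 * m ^ 3 - m\<^sup>2 + b) \<le> (a - 4 * b) * d"
    by (simp add: m2 d_def)
  have "m\<^sup>2 - 1 \<ge> d"
    using m2 \<open>\<not> b > -1\<close> by simp
  moreover have "2 * m\<^sup>2 \<ge> m + 1"
    using m1 mult_strict_left_mono[of 1 m m] unfolding power2_eq_square by linarith
  hence "(m + 1) * (m - 1) \<le> 2 * m\<^sup>2 * (m - 1)"
    using m1 by (intro mult_right_mono) auto
  ultimately have "2 * m\<^sup>2 * (m - 1) \<ge> d"
    by (simp add: algebra_simps power2_eq_square)
  moreover have "2 * m ^ 3 - m\<^sup>2 + b = 2 * m\<^sup>2 * (m - 1) + (m\<^sup>2 + b)"
    by (simp add: algebra_simps eval_nat_numeral)
  ultimately have "2 * m ^ 3 - m\<^sup>2 + b \<ge> 2 * d"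
    using m2 by simp
  hence "(a - 2 * b) * (2 * d) \<le> (a - 2 * b) * (2 * m ^ 3 - m\<^sup>2 + b)"
    using a \<open>\<not> b > -1\<close> by (intro mult_left_mono) auto
  with upper have "(2 * a) * d \<le> a * d" by (simp add: algebra_simps)
  thus False using a d by simp
qed

text \<open>
  With \<open>k = sqrt (1 + b)\<close> the bound reads \<open>a - 2 * b < 2 * (1 + k)\<close>. The discriminant condition
  bounds \<open>a - 2 * b\<close> from above for each \<open>m\<close>. As \<open>k\<close> tends to 0, the choice \<open>m = 1 + \<theta> * k\<close> yields a
  bound below \<open>2 * (1 + k)\<close> whenever \<open>1/3 < \<theta> < 1\<close>; the choice \<open>\<theta> = 1/2\<close> works for all \<open>k > 0\<close>, because the difference
  of the two sides is then a polynomial in \<open>k\<close> with positive coefficients.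
\<close>

lemma bernstein_F_imp_sqrt_bound:
  assumes a: "a > 0" and bern: "bernstein_function (F a b)"
  shows "a < 2 * (1 + b) + 2 * sqrt (1 + b)"
proof (rule ccontr)
  assume contra: "\<not> a < 2 * (1 + b) + 2 * sqrt (1 + b)"
  define k where "k = sqrt (1 + b)"
  define m where "m = 1 + k / 2"
  have "b > -1" using bernstein_F_imp_gt_minus_one[OF a bern] .
  hence k: "k > 0" and b: "b = k\<^sup>2 - 1" by (simp_all add: k_def)
  have large: "a - 2 * b \<ge> 2 * (1 + k)"
    using contra by (simp add: k_def[symmetric] b algebra_simps)
  have "2 * m ^ 3 - m\<^sup>2 + b = 2 * k + 9 / 4 * k\<^sup>2 + k ^ 3 / 4"
    by (simp add: m_def b field_simps eval_nat_numeral)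
  also have "\<dots> \<ge> 0" using k by simp
  finally have "2 * (1 + k) * (2 * m ^ 3 - m\<^sup>2 + b) \<le> (a - 2 * b) * (2 * m ^ 3 - m\<^sup>2 + b)"
    using large by (intro mult_right_mono) auto
  also have "\<dots> \<le> (3 * m\<^sup>2 - b) * (m\<^sup>2 + b)"
  proof (rule bernstein_F_discriminant[OF a bern])
    show "m > 0" using k by (simp add: m_def)
    have "m\<^sup>2 + b = k + 5 / 4 * k\<^sup>2" by (simp add: m_def b field_simps power2_eq_square)
    also have "\<dots> > 0" using k by (simp add: add_pos_pos)
    finally show "m\<^sup>2 > - b" by simp
  qed
  finally have "2 * (1 + k) * (2 * m ^ 3 - m\<^sup>2 + b) - (3 * m\<^sup>2 - b) * (m\<^sup>2 + b) \<le> 0" by simp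
  also have "2 * (1 + k) * (2 * m ^ 3 - m\<^sup>2 + b) - (3 * m\<^sup>2 - b) * (m\<^sup>2 + b)
      = k\<^sup>2 / 2 + 3 / 2 * k ^ 3 + 13 / 16 * k ^ 4"
    by (simp add: m_def b field_simps eval_nat_numeral)
  also have "\<dots> > 0" using k by (simp add: add_pos_pos)
  finally show False by simp
qed

section \<open>The constant K0 and the bound on a - b\<close>

text \<open>
  In terms of \<open>c = 3 * ln 3 - 2\<close> the constant is \<open>(10 * c - 8) / c\<^sup>2\<close>. It changes by about 4.2 times
  the error in \<open>ln 3\<close>, so that seventeen decimals of \<open>ln 3\<close> suffice.
\<close>

lemma K0_approx: "\<bar>K0 - 2.952828006549551\<bar> < 5 / 10 ^ 16"
proof -
  define c where "c = 3 * ln 3 - (2::real)"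
  define c0 :: real where "c0 = 3 * 1.09861228866810969 - 2"
  define c1 :: real where "c1 = 3 * 1.0986122886681097 - 2"
  have "1.09861228866810969 \<le> ln (3::real) \<and> ln (3::real) \<le> 1.0986122886681097"
    using ln_approx_bounds[of 3 28] by (simp add: lessThan_nat_numeral power_divide)
  hence c: "c0 \<le> c" "c \<le> c1"
    by (simp_all add: c_def c0_def c1_def)
  have "c > 0" using c by (simp add: c0_def)
  \<comment> \<open>Chord and tangent bounds of \<open>c\<^sup>2\<close> on the interval turn the two inequalities into linear ones.\<close>
  have "0 \<le> (c - c0) * (c1 - c)" using c by (intro mult_nonneg_nonneg) auto
  hence upper: "c\<^sup>2 \<le> (c0 + c1) * c - c0 * c1" by (simp add: algebra_simps power2_eq_square)
  have "0 \<le> (c - c0)\<^sup>2" by simp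
  hence lower: "c\<^sup>2 \<ge> 2 * c0 * c - c0\<^sup>2" by (simp add: algebra_simps power2_eq_square)
  have K0: "K0 = (10 * c - 8) / c\<^sup>2" by (simp add: K0_def c_def algebra_simps)
  have "(2.952828006549551 - 5 / 10 ^ 16) * c\<^sup>2 < 10 * c - 8"
    using upper c unfolding c0_def c1_def by simp
  moreover have "10 * c - 8 < (2.952828006549551 + 5 / 10 ^ 16) * c\<^sup>2"
    using lower c unfolding c0_def c1_def by (simp add: power2_eq_square)
  ultimately show ?thesis
    using \<open>c > 0\<close> unfolding K0 abs_less_iff by (simp add: field_simps)
qed

text \<open>
  For \<open>b = 0\<close> the quadratic inequality is an upper bound for \<open>a\<close>, equal to \<open>K0\<close> at \<open>t = 1/2\<close>. At
  \<open>t = 1/3\<close> it is about 2.904, which leaves room for a strict inequality and for rational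
  estimates of \<open>ln 2\<close>. For \<open>b < 0\<close> the same \<open>t\<close> bounds \<open>a - b\<close>: with \<open>u = - b \<ge> 0\<close> and
  \<open>a - b = 2.95 + p\<close>, \<open>p \<ge> 0\<close>, the expression that should not be positive is a cubic polynomial in \<open>p\<close>
  and \<open>u\<close> whose only negative coefficient is that of \<open>u\<close>, and the terms in \<open>1\<close> and \<open>u\<^sup>2\<close> outweigh it.
\<close>

lemma bernstein_F_imp_K0_bound:
  assumes a: "a > 0" and bern: "bernstein_function (F a b)"
  shows "a - b < K0"
proof -
  have b: "b \<le> 0" using bernstein_F_imp_nonpos[OF a bern] .
  define w where "w = 2 * ln 2 - (3 / 4 :: real)"
  \<comment> \<open>\<open>v\<close> is the small uncertainty in \<open>w\<close>; the coefficients below keep their signs for all \<open>v\<close> in \<open>{0..1/1000}\<close>.\<close>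
  define v where "v = w - 636 / 1000"
  have "2 * ln 2 \<in> {1.386 .. (1.387 :: real)}"
    using ln_approx_bounds[of 2 4] by (simp add: lessThan_nat_numeral power_divide)
  hence v: "0 \<le> v" "v \<le> 1 / 1000" by (simp_all add: v_def w_def)
  have w: "w = 636 / 1000 + v" by (simp add: v_def)
  have "a - b < 2.95"
  proof (rule ccontr)
    assume "\<not> a - b < 2.95"
    define p where "p = a - b - 2.95"
    define u where "u = - b"
    define L where "L = w * (2.95 + p) + (9 / 4 - w) * u"
    have p: "p \<ge> 0" and u: "u \<ge> 0"
      using \<open>\<not> a - b < 2.95\<close> b by (simp_all add: p_def u_def)
    have ab: "a = 2.95 + p - u" "b = - u" by (simp_all add: p_def u_def)
    have "ln (4 :: real) = 2 * ln 2"
      using ln_realpow[of "2 :: real" 2] by simp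
    hence y: "a * (1 / 3 * (1 / 3 + 1) * ln (1 + 1 / (1 / 3)) - 1 / 3) - b = 4 / 9 * L"
      by (simp add: L_def w_def ab algebra_simps)
    have "0 \<ge> 16 * (2.95 + p + 4 * u) * L\<^sup>2 - 72 * (2.95 + p + 6 * u) * L + 27 * (2.95 + p + 4 * u)\<^sup>2"
      using bernstein_F_quadratic(2)[OF a bern, of "1 / 3", unfolded y]
      by (simp add: ab algebra_simps power2_eq_square)
    moreover have "16 * (2.95 + p + 4 * u) * L\<^sup>2 - 72 * (2.95 + p + 6 * u) * L + 27 * (2.95 + p + 4 * u)\<^sup>2 > 0"
    proof -
      have sq: "v\<^sup>2 \<ge> 0" "v\<^sup>2 \<le> v"
        using v mult_left_le_one_le[of v v] by (simp_all add: power2_eq_square)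
      have "0 \<le> (0.112587968 - 104.095824 * v + 410.758 * v\<^sup>2)
          + (0.11692608 - 81.19344 * v + 278.48 * v\<^sup>2) * u
          + (0.3157216 + 648.9312 * v - 330.4 * v\<^sup>2) * u\<^sup>2
          + (166.719744 - 206.592 * v + 64 * v\<^sup>2) * u ^ 3
          + (58.09326912 + 106.53984 * v + 417.72 * v\<^sup>2) * p
          + (171.5816448 + 304.9536 * v + 188.8 * v\<^sup>2) * (p * u)
          + (173.072448 + 73.536 * v - 112 * v\<^sup>2) * (p * u\<^sup>2)
          + (38.4846336 + 108.1152 * v + 141.6 * v\<^sup>2) * p\<^sup>2
          + (58.735872 + 112.704 * v + 32 * v\<^sup>2) * (p\<^sup>2 * u)
          + (6.471936 + 20.352 * v + 16 * v\<^sup>2) * p ^ 3" (is "0 \<le> ?rest")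
        by (insert v sq, intro add_nonneg_nonneg mult_nonneg_nonneg zero_le_power p u; (simp (no_asm))?; linarith)
      moreover have "16 * (2.95 + p + 4 * u) * L\<^sup>2 - 72 * (2.95 + p + 6 * u) * L + 27 * (2.95 + p + 4 * u)\<^sup>2
          = (2.5 - 5.1 * u + 245 * u\<^sup>2) + ?rest"
        unfolding L_def w by (simp add: field_simps eval_nat_numeral)
      moreover have "2.5 - 5.1 * u + 245 * u\<^sup>2 = 245 * (u - 51 / 4900)\<^sup>2 + 242399 / 98000"
        by (simp add: field_simps power2_eq_square)
      moreover have "\<dots> > 0"
        by (intro add_nonneg_pos) simp_all
      ultimately show ?thesis by linarith
    qed
    ultimately show False by simp
  qed
  also have "2.95 < K0" using K0_approx unfolding abs_less_iff by simp
  finally show ?thesis .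
qed

section \<open>Bernstein functions and complete monotonicity\<close>

text \<open>
  \<open>F\<close> and \<open>P\<close> are each obtained from the other as \<open>c - f\<close> with \<open>c = exp a\<close>, so the next two lemmas
  serve both directions of the equivalence. Smoothness has to be part of the hypothesis,
  since \<open>deriv\<close> respects negation at points of differentiability, but has an unspecified value elsewhere.
\<close>

lemma deriv_const_minus_on_pos:
  assumes f: "smooth_on_pos f" and x: "x > 0"
  shows "(deriv ^^ Suc n) (\<lambda>x. c - f x) x = - (deriv ^^ Suc n) f x"
  using x
proof (induction n arbitrary: x)
  have f_deriv: "((deriv ^^ n) f has_real_derivative (deriv ^^ Suc n) f x) (at x)" if "x > 0" for n x
    using f that by (simp add: smooth_on_pos_def field_differentiable_derivI)
  {
    case 0
    have "((\<lambda>x. c - f x) has_real_derivative - deriv f x) (at x)"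
      using f_deriv[of x 0] 0 by (auto intro!: derivative_eq_intros)
    thus ?case by (simp add: DERIV_imp_deriv)
  next
    case (Suc n)
    show ?case
      unfolding funpow.simps(2)[of "Suc n"] o_apply
      by (rule deriv_eq_on_pos[OF Suc.prems DERIV_minus[OF f_deriv[OF Suc.prems, of "Suc n", unfolded funpow.simps(2)[of "Suc n"] o_apply]] Suc.IH])
  }
qed

lemma smooth_on_pos_const_minus:
  assumes f: "smooth_on_pos f"
  shows "smooth_on_pos (\<lambda>x. c - f x)"
  unfolding smooth_on_pos_def
proof (intro allI impI)
  fix n and x :: real
  assume x: "x > 0"
  have diff: "(deriv ^^ n) f field_differentiable at x" for n
    using f x by (simp add: smooth_on_pos_def)
  show "(deriv ^^ n) (\<lambda>x. c - f x) field_differentiable at x"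
  proof (cases n)
    case 0
    thus ?thesis using diff[of 0] by (auto intro: derivative_intros field_differentiable_diff)
  next
    case (Suc k)
    have "((\<lambda>y. - (deriv ^^ Suc k) f y) has_real_derivative - (deriv ^^ Suc (Suc k)) f x) (at x)"
      using diff[of "Suc k"] by (intro DERIV_minus) (simp add: field_differentiable_derivI)
    hence "((deriv ^^ Suc k) (\<lambda>x. c - f x) has_real_derivative - (deriv ^^ Suc (Suc k)) f x) (at x)"
      by (rule has_field_derivative_transform_within_open[of _ _ _ "{0<..}"])
         (use x deriv_const_minus_on_pos[OF f] in auto)
    thus ?thesis unfolding Suc by (auto simp: field_differentiable_def)
  qed
qed

lemma F_tendsto_exp:
  assumes a: "a > 0"
  shows "(F a b \<longlongrightarrow> exp a) at_top"
proof -
  have "((\<lambda>x. a / x) \<longlongrightarrow> 0) at_top"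
    by (intro tendsto_divide_0[OF tendsto_const] filterlim_at_top_imp_at_infinity filterlim_ident)
  hence "((\<lambda>x. (1 + a / x) powr b) \<longlongrightarrow> (1 + 0) powr b) at_top"
    by (intro tendsto_intros) auto
  from tendsto_mult[OF tendsto_exp_limit_at_top[of a] this]
  show ?thesis by (simp add: F_def[abs_def] powr_add)
qed

text \<open>
  From order one on, the derivatives of \<open>P\<close> are those of \<open>F\<close> negated, so only the conditions of order zero
  differ. One of them, \<open>F \<ge> 0\<close>, is obvious, and the other, \<open>P \<ge> 0\<close>, holds because an
  increasing function stays below its limit at infinity, which is \<open>exp a\<close>.
\<close>

lemma bernstein_F_iff_completely_monotone_P:
  assumes a: "a > 0"
  shows "bernstein_function (F a b) \<longleftrightarrow> completely_monotone (P a b)"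
proof
  assume bern: "bernstein_function (F a b)"
  hence smooth: "smooth_on_pos (F a b)" and cm: "completely_monotone (deriv (F a b))"
    by (simp_all add: bernstein_function_def)
  have P: "P a b = (\<lambda>x. exp a - F a b x)" by (simp add: P_def fun_eq_iff)
  have increasing: "F a b x \<le> F a b z" if "0 < x" "x \<le> z" for x z
  proof (rule DERIV_nonneg_imp_nondecreasing[OF that(2)])
    fix y assume "x \<le> y" "y \<le> z"
    hence y: "y > 0" using that by simp
    have "deriv (F a b) y \<ge> 0"
      using cm y unfolding completely_monotone_def by (metis funpow_0 power_0 mult_1)
    thus "\<exists>D. (F a b has_real_derivative D) (at y) \<and> 0 \<le> D"
      using F_has_derivative[OF a y] DERIV_imp_deriv by metis
  qed
  show "completely_monotone (P a b)"
    unfolding completely_monotone_def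
  proof (intro conjI allI impI)
    show "smooth_on_pos (P a b)" unfolding P by (rule smooth_on_pos_const_minus[OF smooth])
    fix n and x :: real
    assume x: "x > 0"
    show "0 \<le> (-1) ^ n * (deriv ^^ n) (P a b) x"
    proof (cases n)
      case 0
      have "F a b x \<le> exp a"
      proof (rule tendsto_lowerbound[OF F_tendsto_exp[OF a]])
        show "\<forall>\<^sub>F z in at_top. F a b x \<le> F a b z"
          using eventually_ge_at_top[of x] by eventually_elim (use increasing x in auto)
      qed simp
      thus ?thesis by (simp add: 0 P_def)
    next
      case (Suc k)
      have "0 \<le> (-1) ^ k * (deriv ^^ k) (deriv (F a b)) x"
        using cm x by (simp add: completely_monotone_def)
      thus ?thesis
        unfolding Suc P deriv_const_minus_on_pos[OF smooth x] by (simp add: funpow_swap1)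
    qed
  qed
next
  assume cm: "completely_monotone (P a b)"
  hence smooth: "smooth_on_pos (P a b)" by (simp add: completely_monotone_def)
  have F: "F a b = (\<lambda>x. exp a - P a b x)" by (simp add: P_def fun_eq_iff)
  have smooth_F: "smooth_on_pos (F a b)"
    unfolding F by (rule smooth_on_pos_const_minus[OF smooth])
  have "completely_monotone (deriv (F a b))"
    unfolding completely_monotone_def
  proof (intro conjI allI impI)
    show "smooth_on_pos (deriv (F a b))"
      using smooth_F unfolding smooth_on_pos_def by (metis funpow_Suc_right o_apply)
    fix n and x :: real
    assume x: "x > 0"
    have "(deriv ^^ n) (deriv (F a b)) x = - (deriv ^^ Suc n) (P a b) x"
      using deriv_const_minus_on_pos[OF smooth x, of n "exp a"] unfolding F by (simp add: funpow_swap1)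
    moreover have "0 \<le> (-1) ^ Suc n * (deriv ^^ Suc n) (P a b) x"
      using cm x unfolding completely_monotone_def by blast
    ultimately show "0 \<le> (-1) ^ n * (deriv ^^ n) (deriv (F a b)) x" by simp
  qed
  thus "bernstein_function (F a b)"
    using smooth_F F_pos[OF a] by (simp add: bernstein_function_def less_imp_le)
qed

theorem proposition2:
  fixes a b :: real
  assumes "a > 0"
  shows "(bernstein_function (F a b) \<longleftrightarrow> completely_monotone (P a b)) \<and>
    (bernstein_function (F a b) \<longrightarrow>
       -1 < b \<and> b \<le> 0 \<and>
       0 < a \<and> a < min (K0 + b) (2 * (1 + b) + 2 * sqrt (1 + b)) \<and>
       a - b < K0) \<and>
    K0 < 3 \<and>
    \<bar>K0 - 2.952828006549551\<bar> < 5 / 10 ^ 16"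
proof (intro conjI impI)
  assume bern: "bernstein_function (F a b)"
  show "-1 < b" "b \<le> 0" "a - b < K0"
    using bernstein_F_imp_gt_minus_one[OF assms bern] bernstein_F_imp_nonpos[OF assms bern]
      bernstein_F_imp_K0_bound[OF assms bern] by auto
  thus "a < min (K0 + b) (2 * (1 + b) + 2 * sqrt (1 + b))"
    using bernstein_F_imp_sqrt_bound[OF assms bern] by simp
next
  show "K0 < 3" using K0_approx unfolding abs_less_iff by simp
qed (use assms K0_approx bernstein_F_iff_completely_monotone_P[OF assms] in auto)

end
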